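(* Let $K \geq 1$ be an integer and $\lambda > 0$. The Mondrian Forest classifier with $K$ trees and constant lifetime sequence $\lambda_n = \lambda$ is inconsistent: there exists a distribution of $(X,Y)$ on $[0,1] \times \{0,1\}$ such that $L^* = 0$ and, writing $g_n$ for this classifier trained on $n$ i.i.d. copies of $(X,Y)$, $L(g_n) = \mathbb P(g_n(X) \neq Y)$ does not tend to $0$ as $n \to \infty$. The same result holds for the range-restricted (original) Mondrian Forest algorithm with lifetime $\lambda$.
   Context: Mondrian process. For a box $C = \prod_{j=1}^d [a_j,b_j]$ (here $d=1$), write $|C| = \sum_{j=1}^d (b_j-a_j)$. For $\lambda > 0$, $\mathrm{MP}(\lambda, C)$ is the distribution of the random tree partition of $C$ produced by calling $\mathrm{SplitCell}(C,0,\lambda)$, where $\mathrm{SplitCell}(A,\tau,\lambda)$, for a cell $A$ with sides $[a_j,b_j]$, is defined recursively: draw an exponential variable $E_A$ with rate $|A|$ (independent of everything else; $E_A = +\infty$ if $|A|=0$). If $\tau + E_A \leq \lambda$, draw a split dimension $J \in \{1,\dots,d\}$ with $\mathbb P(J=j) = (b_j-a_j)/|A|$ and a threshold $\nu$ uniform on $[a_J,b_J]$, split $A$ into $\{x \in A : x_J \leq \nu\}$ and $\{x \in A : x_J > \nu\}$, and call $\mathrm{SplitCell}(\cdot, \tau + E_A, \lambda)$ on both children (with fresh independent randomness). Otherwise do nothing, so $A$ is a leaf cell. Mondrian Forest with constant lifetime $\lambda$. $K$ i.i.d. partitions with distribution $\mathrm{MP}(\lambda,[0,1])$ are drawn, independently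 of the data $(X_1,Y_1),\dots,(X_n,Y_n)$ and of $(X,Y)$. Each tree predicts at $x$ the majority label among the $Y_i$, $1\le i\le n$, such that $X_i$ lies in the leaf cell containing $x$ (label $0$ if there is no such $X_i$ or in case of a tie). The forest classifier $g_n$ is the majority vote of the $K$ trees (ties giving $0$). Range-restricted (original) Mondrian Forest with lifetime $\lambda$. The same, except that, given $X_1,\dots,X_n$, each tree is built by replacing every call $\mathrm{SplitCell}(A,\tau,\lambda)$ by $\mathrm{SplitCell}(A^{\mathrm{range}(n)},\tau,\lambda)$, where $A^{\mathrm{range}(n)}$ is the smallest box containing the points among $X_1,\dots,X_n$ that lie in $A$. An arbitrary point $x$ is assigned to a leaf by following the splits ($x_J \le \nu$: left, $x_J>\nu$: right) from the root. The probability $\mathbb P(g_n(X)\neq Y)$ is over the data, the trees and an independent copy $(X,Y)$. $L^*$ is the Bayes error, i.e. $L^* = \mathbb P(g^*(X)\neq Y)$ with $g^*(x) = \mathbf 1_{\{\mathbb P(Y=1\mid X=x) > 1/2\}}$. *)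

theory Defs
  imports "HOL-Probability.Probability"
begin

text \<open>
  Every potential node of a tree carries its own independent pair \<open>(e, u)\<close>, where \<open>e\<close> is
  exponential with rate \<open>1\<close> and \<open>u\<close> is uniform on \<open>[0,1]\<close>. A cell with endpoints \<open>a < b\<close> uses
  \<open>e / (b - a)\<close> as its exponential time and \<open>a + u * (b - a)\<close> as its threshold; the two lemmas
  below say that these have the laws required by the algorithm. Nodes are addressed by the list
  of branches leading to them from the root, \<open>False\<close> meaning left and \<open>True\<close> meaning right.
\<close>

type_synonym seed = "bool list \<Rightarrow> real \<times> real"

definition node_seed_measure :: "(real \<times> real) measure" where
  "node_seed_measure =
     density lborel (exponential_density 1) \<Otimes>\<^sub>M uniform_measure lborel {0..1}"

definition seed_measure :: "seed measure" where
  "seed_measure = PiM UNIV (\<lambda>_. node_seed_measure)"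

lemma exponential_scaling:
  fixes l :: real
  assumes "0 < l"
  shows "distr (density lborel (exponential_density 1)) borel (\<lambda>e. e / l)
           = density lborel (exponential_density l)"
proof -
  let ?M = "density lborel (exponential_density 1)"
  interpret prob_space ?M
    by (rule prob_space_exponential_density) simp
  have X: "distributed ?M lborel (\<lambda>x. x) (exponential_density 1)"
    by (auto simp: distributed_def distr_id2)
  have "distributed ?M lborel (\<lambda>e. e / l) (exponential_density l)"
    using assms exponential_distributedD_le[OF X]
    by (subst exponential_distributed_iff) (auto simp: pos_divide_le_eq mult.commute)
  then have "distr ?M lborel (\<lambda>e. e / l) = density lborel (exponential_density l)"
    by (simp add: distributed_def)
  moreover have "distr ?M lborel (\<lambda>e. e / l) = distr ?M borel (\<lambda>e. e / l)"
    by (rule distr_cong) auto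
  ultimately show ?thesis by simp
qed

lemma uniform_scaling:
  fixes a b :: real
  assumes "a < b"
  shows "distr (uniform_measure lborel {0..1}) borel (\<lambda>u. a + u * (b - a))
           = uniform_measure lborel {a..b}"
proof (rule measure_eqI)
  show "sets (distr (uniform_measure lborel {0..1}) borel (\<lambda>u. a + u * (b - a)))
          = sets (uniform_measure lborel {a..b})"
    by simp
next
  fix S assume "S \<in> sets (distr (uniform_measure lborel {0..1}) borel (\<lambda>u. a + u * (b - a)))"
  then have S[measurable]: "S \<in> sets borel" by simp
  let ?T = "\<lambda>u. a + u * (b - a)"
  have T[measurable]: "?T -` S \<in> sets borel"
    using measurable_sets_borel[of ?T borel S] by simp
  have "emeasure lborel ({a..b} \<inter> S) = (\<integral>\<^sup>+x. indicator ({a..b} \<inter> S) x \<partial>lborel)"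
    by simp
  also have "\<dots> = ennreal (b - a) * (\<integral>\<^sup>+x. indicator ({a..b} \<inter> S) (a + (b - a) * x) \<partial>lborel)"
    using assms by (subst nn_integral_real_affine[where c = "b - a" and t = a]) auto
  also have "(\<lambda>x. indicator ({a..b} \<inter> S) (a + (b - a) * x) :: ennreal)
               = indicator ({0..1} \<inter> ?T -` S)"
  proof
    fix x
    have "a \<le> a + (b - a) * x \<longleftrightarrow> 0 \<le> x"
      using assms by (simp add: zero_le_mult_iff)
    moreover have "a + (b - a) * x \<le> b \<longleftrightarrow> x \<le> 1"
    proof -
      have "a + (b - a) * x \<le> b \<longleftrightarrow> (b - a) * x \<le> (b - a) * 1" by auto
      then show ?thesis using assms by (simp only: mult_le_cancel_left_pos diff_gt_0_iff_gt)
    qed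
    ultimately show "(indicator ({a..b} \<inter> S) (a + (b - a) * x) :: ennreal)
                       = indicator ({0..1} \<inter> ?T -` S) x"
      by (simp add: indicator_def mult.commute)
  qed
  finally have *: "emeasure lborel ({a..b} \<inter> S)
      = ennreal (b - a) * emeasure lborel ({0..1} \<inter> ?T -` S)"
    by simp
  have "emeasure (uniform_measure lborel {a..b}) S
          = emeasure lborel ({0..1} \<inter> ?T -` S)"
    using assms * mult_divide_eq_ennreal[of "ennreal (b - a)"]
    by (simp add: mult.commute[of "ennreal (b - a)"] Int_commute)
  then show "emeasure (distr (uniform_measure lborel {0..1}) borel ?T) S
               = emeasure (uniform_measure lborel {a..b}) S"
    by (simp add: emeasure_distr divide_ennreal_def)
qed

text \<open>
  Cells are intervals, represented as sets. Trees are coinductive so that the recursion needs no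
  termination argument; they are finite almost surely.
\<close>

definition cell_length :: "real set \<Rightarrow> real" where
  "cell_length A = (if A = {} then 0 else Sup A - Inf A)"

codatatype mtree = Leaf | Split real mtree mtree

text \<open>
  The argument \<open>R\<close> is applied to the cell at every call: it is the identity for the Mondrian
  process, and the range restriction for the original Mondrian Forest. In dimension one the
  split dimension is deterministic. The children use disjoint parts of the seed.
\<close>

primcorec split_cell ::
  "(real set \<Rightarrow> real set) \<Rightarrow> real \<Rightarrow> seed \<Rightarrow> real set \<Rightarrow> real \<Rightarrow> mtree" where
  "split_cell R lam \<omega> A \<tau> =
     (let B = R A;
          t = \<tau> + fst (\<omega> []) / cell_length B;
          \<nu> = Inf B + snd (\<omega> []) * cell_length B
      in if cell_length B > 0 \<and> t \<le> lam
         then Split \<nu> (split_cell R lam (\<lambda>p. \<omega> (False # p)) {x \<in> B. x \<le> \<nu>} t)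
                      (split_cell R lam (\<lambda>p. \<omega> (True # p)) {x \<in> B. x > \<nu>} t)
         else Leaf)"

fun reaches_leaf :: "mtree \<Rightarrow> real \<Rightarrow> bool list \<Rightarrow> bool" where
  "reaches_leaf t x [] \<longleftrightarrow> t = Leaf"
| "reaches_leaf t x (right # p) \<longleftrightarrow>
     (case t of Leaf \<Rightarrow> False
      | Split \<nu> t1 t2 \<Rightarrow>
          if x \<le> \<nu> then \<not> right \<and> reaches_leaf t1 x p else right \<and> reaches_leaf t2 x p)"

text \<open>
  Points outside a restricted cell are assigned to a leaf as well, so leaf cells are read off the
  splits. On \<open>[0,1]\<close>, without range restriction, these are the cells of the partition.
\<close>

definition leaf_cell :: "mtree \<Rightarrow> real \<Rightarrow> real set" where
  "leaf_cell t x = {y. \<exists>p. reaches_leaf t x p \<and> reaches_leaf t y p}"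

text \<open>A sample of size \<open>n\<close> is a function on \<open>{..<n}\<close>; the labels 1 and 0 are \<open>True\<close> and \<open>False\<close>.\<close>

type_synonym sample = "nat \<Rightarrow> real \<times> bool"

definition majority :: "nat set \<Rightarrow> (nat \<Rightarrow> bool) \<Rightarrow> bool" where
  "majority I v \<longleftrightarrow> card {i \<in> I. v i} > card {i \<in> I. \<not> v i}"

definition tree_classifier :: "nat \<Rightarrow> sample \<Rightarrow> mtree \<Rightarrow> real \<Rightarrow> bool" where
  "tree_classifier n Z t x = majority {i. i < n \<and> fst (Z i) \<in> leaf_cell t x} (\<lambda>i. snd (Z i))"

definition forest_classifier ::
  "nat \<Rightarrow> nat \<Rightarrow> sample \<Rightarrow> (nat \<Rightarrow> mtree) \<Rightarrow> real \<Rightarrow> bool" where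
  "forest_classifier K n Z T x = majority {..<K} (\<lambda>k. tree_classifier n Z (T k) x)"

definition mondrian_tree :: "real \<Rightarrow> seed \<Rightarrow> mtree" where
  "mondrian_tree lam \<omega> = split_cell (\<lambda>A. A) lam \<omega> {0..1} 0"

definition range_box :: "nat \<Rightarrow> sample \<Rightarrow> real set \<Rightarrow> real set" where
  "range_box n Z A =
     (let S = {fst (Z i) | i. i < n \<and> fst (Z i) \<in> A}
      in if S = {} then {} else {Min S..Max S})"

definition range_restricted_tree :: "real \<Rightarrow> nat \<Rightarrow> sample \<Rightarrow> seed \<Rightarrow> mtree" where
  "range_restricted_tree lam n Z \<omega> = split_cell (range_box n Z) lam \<omega> {0..1} 0"

definition mondrian_forest ::
  "nat \<Rightarrow> real \<Rightarrow> nat \<Rightarrow> sample \<Rightarrow> (nat \<Rightarrow> seed) \<Rightarrow> real \<Rightarrow> bool" where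
  "mondrian_forest K lam n Z \<omega> = forest_classifier K n Z (\<lambda>k. mondrian_tree lam (\<omega> k))"

definition range_restricted_mondrian_forest ::
  "nat \<Rightarrow> real \<Rightarrow> nat \<Rightarrow> sample \<Rightarrow> (nat \<Rightarrow> seed) \<Rightarrow> real \<Rightarrow> bool" where
  "range_restricted_mondrian_forest K lam n Z \<omega> =
     forest_classifier K n Z (\<lambda>k. range_restricted_tree lam n Z (\<omega> k))"

definition data_distribution :: "(real \<times> bool) measure \<Rightarrow> bool" where
  "data_distribution D \<longleftrightarrow>
     prob_space D \<and> sets D = sets (borel \<Otimes>\<^sub>M count_space UNIV) \<and> (AE z in D. fst z \<in> {0..1})"

definition joint_measure ::
  "(real \<times> bool) measure \<Rightarrow> nat \<Rightarrow> nat
     \<Rightarrow> (sample \<times> (nat \<Rightarrow> seed) \<times> (real \<times> bool)) measure" where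
  "joint_measure D K n =
     PiM {..<n} (\<lambda>_. D) \<Otimes>\<^sub>M (PiM {..<K} (\<lambda>_. seed_measure) \<Otimes>\<^sub>M D)"

definition risk ::
  "(real \<times> bool) measure \<Rightarrow> nat \<Rightarrow> nat
     \<Rightarrow> (sample \<Rightarrow> (nat \<Rightarrow> seed) \<Rightarrow> real \<Rightarrow> bool) \<Rightarrow> real" where
  "risk D K n g = \<P>((Z, \<omega>, x, y) in joint_measure D K n. g Z \<omega> x \<noteq> y)"

text \<open>
  The conditional probability of \<open>Y = 1\<close> given \<open>X\<close> and the Bayes classifier are taken as random
  variables on the space of pairs \<open>(x, y)\<close>, measurable with respect to the first component.
\<close>

definition label_prob :: "(real \<times> bool) measure \<Rightarrow> real \<times> bool \<Rightarrow> real" where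
  "label_prob D = real_cond_exp D (vimage_algebra (space D) fst borel) (\<lambda>z. of_bool (snd z))"

definition bayes_error :: "(real \<times> bool) measure \<Rightarrow> real" where
  "bayes_error D = \<P>(z in D. (label_prob D z > 1 / 2) \<noteq> snd z)"

end

theory Submission
  imports Defs
begin

text \<open>
  Let \<open>X\<close> be uniform on \<open>{0, 1}\<close> and \<open>Y = X\<close>, so that the Bayes error vanishes. With probability
  at least \<open>exp (- lam) ^ K\<close>, whatever \<open>n\<close>, the exponential times of all \<open>K\<close> roots exceed \<open>lam\<close>; the
  root cells have length at most \<open>1\<close>, so no tree is split and the forest predicts the majority
  label of the whole sample everywhere, which is wrong for half of the new points.

  As the measure of a non-measurable set is \<open>0\<close>, the lower bound on the risk also requires the
  error event to be measurable. Every cell that occurs is an interval whose endpoints are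
  measurable functions of the sample and the seeds.
\<close>

section \<open>Intervals whose endpoints are random variables\<close>

text \<open>
  The two lower bounds cover both the closed root and restricted cells and the half-open right
  children.
\<close>

definition cell_between :: "real \<Rightarrow> real \<Rightarrow> real \<Rightarrow> real set" where
  "cell_between a l r = {x. a \<le> x \<and> l < x \<and> x \<le> r}"

lemma mem_cell_between [simp]: "x \<in> cell_between a l r \<longleftrightarrow> a \<le> x \<and> l < x \<and> x \<le> r"
  by (simp add: cell_between_def)

lemma Inf_cell_between:
  assumes "a \<le> r" "l < r"
  shows "Inf (cell_between a l r) = max a l"
proof (cases "l < a")
  case True
  then have "cell_between a l r = {a..r}" by auto
  then show ?thesis using assms True by simp
next
  case False
  then have "cell_between a l r = {l<..r}" by auto
  then show ?thesis using assms False by simp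
qed

lemma Sup_cell_between:
  assumes "a \<le> r" "l < r"
  shows "Sup (cell_between a l r) = r"
  using assms by (intro cSup_eq_maximum) auto

text \<open>The test \<open>a \<le> r \<and> l < r\<close> says that \<open>r\<close> lies in the
  cell, which is equivalent to the cell being nonempty.\<close>

lemma cell_length_cell_between:
  "cell_length (cell_between a l r) = (if a \<le> r \<and> l < r then r - max a l else 0)"
proof (cases "a \<le> r \<and> l < r")
  case True
  then have "r \<in> cell_between a l r" by simp
  then have "cell_between a l r \<noteq> {}" by blast
  then show ?thesis
    using True by (simp add: cell_length_def Inf_cell_between Sup_cell_between)
next
  case False
  then have "cell_between a l r = {}" by auto
  then show ?thesis using False by (auto simp: cell_length_def)
qed

text \<open>Measurability of a random cell is expressed through its bounds, which avoids a
  sigma-algebra on sets of reals. An empty cell is given by any contradictory bounds.\<close>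

definition measurable_cell :: "'m measure \<Rightarrow> ('m \<Rightarrow> real set) \<Rightarrow> bool" where
  "measurable_cell M A \<longleftrightarrow>
     (\<exists>a\<in>borel_measurable M. \<exists>l\<in>borel_measurable M. \<exists>r\<in>borel_measurable M.
        \<forall>m\<in>space M. A m = cell_between (a m) (l m) (r m))"

lemma measurable_cellI:
  assumes "a \<in> borel_measurable M" "l \<in> borel_measurable M" "r \<in> borel_measurable M"
    and "\<And>m. m \<in> space M \<Longrightarrow> A m = cell_between (a m) (l m) (r m)"
  shows "measurable_cell M A"
  using assms unfolding measurable_cell_def by blast

lemma measurable_cell_unit: "measurable_cell M (\<lambda>_. {0..1})"
  by (rule measurable_cellI[of "\<lambda>_. 0" _ "\<lambda>_. -1" "\<lambda>_. 1"]) auto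

section \<open>Measurability of the leaf assignment\<close>

lemma split_cell_eq_Leaf:
  assumes "\<not> (cell_length (R A) > 0 \<and> \<tau> + fst (\<omega> []) / cell_length (R A) \<le> lam)"
  shows "split_cell R lam \<omega> A \<tau> = Leaf"
  using assms by (subst split_cell.code) (simp add: Let_def)

lemma split_cell_eq_Split:
  assumes "cell_length (R A) > 0" "\<tau> + fst (\<omega> []) / cell_length (R A) \<le> lam"
  defines "t \<equiv> \<tau> + fst (\<omega> []) / cell_length (R A)"
    and "\<nu> \<equiv> Inf (R A) + snd (\<omega> []) * cell_length (R A)"
  shows "split_cell R lam \<omega> A \<tau> =
    Split \<nu> (split_cell R lam (\<lambda>p. \<omega> (False # p)) {x \<in> R A. x \<le> \<nu>} t)
            (split_cell R lam (\<lambda>p. \<omega> (True # p)) {x \<in> R A. x > \<nu>} t)"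
  unfolding t_def \<nu>_def using assms(1,2) by (subst split_cell.code) (simp add: Let_def)

text \<open>A fixed address \<open>p\<close> inspects only finitely many nodes, so induction on
  \<open>p\<close> works although the tree itself may be infinite. Cell, time and seed are
  generalised because the recursion changes them; \<open>R\<close> may depend on \<open>m\<close>
  because range restriction depends on the sample.\<close>

lemma pred_reaches_leaf:
  fixes \<omega> :: "'m \<Rightarrow> seed"
  assumes R: "\<And>A. measurable_cell M A \<Longrightarrow> measurable_cell M (\<lambda>m. R m (A m))"
    and x [measurable]: "x \<in> borel_measurable M"
    and A: "measurable_cell M A"
    and \<tau> [measurable]: "\<tau> \<in> borel_measurable M"
    and \<omega> [measurable]: "\<And>p. (\<lambda>m. \<omega> m p) \<in> M \<rightarrow>\<^sub>M borel \<Otimes>\<^sub>M borel"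
  shows "Measurable.pred M (\<lambda>m. reaches_leaf (split_cell (R m) lam (\<omega> m) (A m) (\<tau> m)) (x m) p)"
  using A \<tau> \<omega>
proof (induction p arbitrary: A \<tau> \<omega>)
  case (Nil A \<tau> \<omega>)
  note [measurable] = Nil(2,3)
  obtain a l r where [measurable]: "a \<in> borel_measurable M" "l \<in> borel_measurable M"
      "r \<in> borel_measurable M"
    and RA: "\<And>m. m \<in> space M \<Longrightarrow> R m (A m) = cell_between (a m) (l m) (r m)"
    using R[OF Nil(1)] unfolding measurable_cell_def by blast
  define len where "len m = (if a m \<le> r m \<and> l m < r m then r m - max (a m) (l m) else 0)" for m
  have [measurable]: "len \<in> borel_measurable M"
    unfolding len_def by measurable
  have len: "cell_length (R m (A m)) = len m" if "m \<in> space M" for m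
    using that by (simp add: RA cell_length_cell_between len_def)
  have "reaches_leaf (split_cell (R m) lam (\<omega> m) (A m) (\<tau> m)) (x m) []
          \<longleftrightarrow> \<not> (len m > 0 \<and> \<tau> m + fst (\<omega> m []) / len m \<le> lam)" if "m \<in> space M" for m
    using split_cell_eq_Leaf[of "R m" "A m" "\<tau> m" "\<omega> m" lam]
      split_cell_eq_Split[of "R m" "A m" "\<tau> m" "\<omega> m" lam] len[OF that] by auto
  then show ?case
    by (subst measurable_cong) (assumption, measurable)
next
  case (Cons b p A \<tau> \<omega>)
  note [measurable] = Cons.prems(2,3)
  obtain a l r where [measurable]: "a \<in> borel_measurable M" "l \<in> borel_measurable M"
      "r \<in> borel_measurable M"
    and RA: "\<And>m. m \<in> space M \<Longrightarrow> R m (A m) = cell_between (a m) (l m) (r m)"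
    using R[OF Cons.prems(1)] unfolding measurable_cell_def by blast
  define len where "len m = (if a m \<le> r m \<and> l m < r m then r m - max (a m) (l m) else 0)" for m
  have [measurable]: "len \<in> borel_measurable M"
    unfolding len_def by measurable
  have len: "cell_length (R m (A m)) = len m" if "m \<in> space M" for m
    using that by (simp add: RA cell_length_cell_between len_def)
  define t where "t m = \<tau> m + fst (\<omega> m []) / len m" for m
  have [measurable]: "t \<in> borel_measurable M"
    unfolding t_def by measurable
  \<comment> \<open>The infimum is replaced by \<open>max (a m) (l m)\<close>. The two agree when
    the cell has positive length, and only then is the threshold used.\<close>
  define \<nu> where "\<nu> m = max (a m) (l m) + snd (\<omega> m []) * len m" for m
  have [measurable]: "\<nu> \<in> borel_measurable M"
    unfolding \<nu>_def by measurable
  have \<nu>: "Inf (R m (A m)) + snd (\<omega> m []) * len m = \<nu> m" if "m \<in> space M" "len m > 0" for m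
    using that by (auto simp: RA \<nu>_def len_def Inf_cell_between split: if_splits)
  define L where "L m = {x \<in> R m (A m). x \<le> \<nu> m}" for m
  define U where "U m = {x \<in> R m (A m). x > \<nu> m}" for m
  define tL where "tL m = split_cell (R m) lam (\<lambda>p. \<omega> m (False # p)) (L m) (t m)" for m
  define tU where "tU m = split_cell (R m) lam (\<lambda>p. \<omega> m (True # p)) (U m) (t m)" for m
  \<comment> \<open>Cutting at the threshold keeps the three-bound form: the left child lowers the
    upper bound, the right child raises the strict lower bound.\<close>
  have "measurable_cell M L"
    by (rule measurable_cellI[of a _ l "\<lambda>m. min (r m) (\<nu> m)"]) (auto simp: L_def RA)
  then have [measurable]: "Measurable.pred M (\<lambda>m. reaches_leaf (tL m) (x m) p)"
    unfolding tL_def by (rule Cons.IH) measurable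
  have "measurable_cell M U"
    by (rule measurable_cellI[of a _ "\<lambda>m. max (l m) (\<nu> m)" r]) (auto simp: U_def RA)
  then have [measurable]: "Measurable.pred M (\<lambda>m. reaches_leaf (tU m) (x m) p)"
    unfolding tU_def by (rule Cons.IH) measurable
  have "reaches_leaf (split_cell (R m) lam (\<omega> m) (A m) (\<tau> m)) (x m) (b # p)
          \<longleftrightarrow> len m > 0 \<and> t m \<le> lam \<and>
              (if x m \<le> \<nu> m then \<not> b \<and> reaches_leaf (tL m) (x m) p
               else b \<and> reaches_leaf (tU m) (x m) p)" if m: "m \<in> space M" for m
  proof (cases "len m > 0 \<and> t m \<le> lam")
    case True
    then have "split_cell (R m) lam (\<omega> m) (A m) (\<tau> m) = Split (\<nu> m) (tL m) (tU m)"
      using split_cell_eq_Split[of "R m" "A m" "\<tau> m" "\<omega> m" lam] len[OF m] \<nu>[OF m]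
      by (simp add: t_def tL_def tU_def L_def U_def)
    then show ?thesis using True by simp
  next
    case False
    then have Leaf: "split_cell (R m) lam (\<omega> m) (A m) (\<tau> m) = Leaf"
      using len[OF m] by (intro split_cell_eq_Leaf) (simp add: t_def)
    show ?thesis unfolding Leaf using False by auto
  qed
  then show ?case
    by (subst measurable_cong) (assumption, measurable)
qed

text \<open>The new endpoints are a minimum and a maximum of finitely many random variables. The
  difficulty is that the set of indices they range over is itself random.\<close>

lemma measurable_cell_range_box:
  assumes [measurable]: "\<And>i. i < n \<Longrightarrow> (\<lambda>m. fst (Z m i)) \<in> borel_measurable M"
    and A: "measurable_cell M A"
  shows "measurable_cell M (\<lambda>m. range_box n (Z m) (A m))"
proof -
  obtain a l r where [measurable]: "a \<in> borel_measurable M" "l \<in> borel_measurable M"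
      "r \<in> borel_measurable M"
    and A: "\<And>m. m \<in> space M \<Longrightarrow> A m = cell_between (a m) (l m) (r m)"
    using A unfolding measurable_cell_def by blast
  define In where "In m i \<longleftrightarrow> a m \<le> fst (Z m i) \<and> l m < fst (Z m i) \<and> fst (Z m i) \<le> r m" for m i
  have [measurable]: "Measurable.pred M (\<lambda>m. In m i)" if "i < n" for i
    using that unfolding In_def by measurable
  have [measurable]: "Measurable.pred M (\<lambda>m. \<exists>i\<in>{..<n}. In m i)"
    by measurable
  \<comment> \<open>Points outside the cell are moved to its right (left) end, where they do not affect the
    minimum (maximum) over the points inside.\<close>
  define lo where "lo m = Min ((\<lambda>i. if In m i then fst (Z m i) else r m) ` {..<n})" for m
  define hi where "hi m = Max ((\<lambda>i. if In m i then fst (Z m i) else a m) ` {..<n})" for m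
  have [measurable]: "lo \<in> borel_measurable M"
    unfolding lo_def by (rule borel_measurable_Min) (auto intro!: measurable_If)
  have [measurable]: "hi \<in> borel_measurable M"
    unfolding hi_def by (rule borel_measurable_Max) (auto intro!: measurable_If)
  show ?thesis
  proof (rule measurable_cellI)
    fix m assume m: "m \<in> space M"
    define S where "S = {fst (Z m i) | i. i < n \<and> fst (Z m i) \<in> A m}"
    have S: "S = (\<lambda>i. fst (Z m i)) ` {i \<in> {..<n}. In m i}"
      by (auto simp: S_def In_def A[OF m])
    have "finite S" unfolding S by simp
    \<comment> \<open>If no sample point lies in the cell, the bounds \<open>1\<close>,
      \<open>0\<close>, \<open>0\<close> describe the empty set. Otherwise the strict bound
      \<open>lo m - 1\<close> is inactive and the cell is the closed interval from
      \<open>lo m\<close> to \<open>hi m\<close>.\<close>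
    show "range_box n (Z m) (A m) =
      cell_between (if \<exists>i\<in>{..<n}. In m i then lo m else 1)
        (if \<exists>i\<in>{..<n}. In m i then lo m - 1 else 0) (if \<exists>i\<in>{..<n}. In m i then hi m else 0)"
    proof (cases "\<exists>i\<in>{..<n}. In m i")
      case True
      then have "S \<noteq> {}" unfolding S by auto
      have "Min S = lo m"
      proof (rule Min_eqI[OF \<open>finite S\<close>])
        fix y assume "y \<in> S"
        then show "lo m \<le> y" unfolding lo_def S by (intro Min_le) force+
      next
        have "lo m \<in> (\<lambda>i. if In m i then fst (Z m i) else r m) ` {..<n}"
          unfolding lo_def using True by (intro Min_in) auto
        then obtain i where i: "i < n" "lo m = (if In m i then fst (Z m i) else r m)" by auto
        show "lo m \<in> S"
        proof (cases "In m i")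
          case False
          \<comment> \<open>If the minimum is the default value \<open>r m\<close>, a point
            \<open>j\<close> of the cell is squeezed:
            \<open>lo m \<le> fst (Z m j) \<le> r m = lo m\<close>. The maximum is treated
            symmetrically.\<close>
          obtain j where j: "j < n" "In m j" using True by auto
          have "lo m \<le> fst (Z m j)" unfolding lo_def using j by (intro Min_le) force+
          then have "lo m = fst (Z m j)" using i j False by (auto simp: In_def)
          then show ?thesis unfolding S using j by auto
        qed (use i in \<open>auto simp: S\<close>)
      qed
      moreover have "Max S = hi m"
      proof (rule Max_eqI[OF \<open>finite S\<close>])
        fix y assume "y \<in> S"
        then show "y \<le> hi m" unfolding hi_def S by (intro Max_ge) force+
      next
        have "hi m \<in> (\<lambda>i. if In m i then fst (Z m i) else a m) ` {..<n}"
          unfolding hi_def using True by (intro Max_in) auto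
        then obtain i where i: "i < n" "hi m = (if In m i then fst (Z m i) else a m)" by auto
        show "hi m \<in> S"
        proof (cases "In m i")
          case False
          obtain j where j: "j < n" "In m j" using True by auto
          have "fst (Z m j) \<le> hi m" unfolding hi_def using j by (intro Max_ge) force+
          then have "hi m = fst (Z m j)" using i j False by (auto simp: In_def)
          then show ?thesis unfolding S using j by auto
        qed (use i in \<open>auto simp: S\<close>)
      qed
      ultimately show ?thesis
        using True \<open>S \<noteq> {}\<close> by (auto simp: range_box_def S_def[symmetric] Let_def)
    next
      case False
      then have "S = {}" unfolding S by auto
      then show ?thesis
        using False by (auto simp: range_box_def S_def[symmetric] Let_def)
    qed
  qed measurable
qed

section \<open>Measurability of majority votes\<close>

text \<open>Cardinalities of random index sets become finite sums of indicators over the fixed set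
  \<open>J\<close>.\<close>

lemma pred_majority:
  assumes "finite J" and [measurable]: "\<And>i. i \<in> J \<Longrightarrow> Measurable.pred M (\<lambda>m. P m i)"
    and [measurable]: "\<And>i. i \<in> J \<Longrightarrow> Measurable.pred M (\<lambda>m. v m i)"
  shows "Measurable.pred M (\<lambda>m. majority {i \<in> J. P m i} (v m))"
proof -
  have "majority {i \<in> J. P m i} (v m) \<longleftrightarrow>
    (\<Sum>i\<in>J. of_bool (P m i \<and> v m i)) > (\<Sum>i\<in>J. of_bool (P m i \<and> \<not> v m i) :: real)" for m
  proof -
    have "{i \<in> {i \<in> J. P m i}. v m i} = {i \<in> J. P m i \<and> v m i}"
      "{i \<in> {i \<in> J. P m i}. \<not> v m i} = {i \<in> J. P m i \<and> \<not> v m i}" by auto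
    then show ?thesis
      using \<open>finite J\<close> by (simp add: majority_def sum_of_bool_eq Int_def)
  qed
  moreover have "Measurable.pred M (\<lambda>m.
    (\<Sum>i\<in>J. of_bool (P m i \<and> v m i)) > (\<Sum>i\<in>J. of_bool (P m i \<and> \<not> v m i) :: real))"
    unfolding of_bool_def by measurable
  ultimately show ?thesis by simp
qed

lemma pred_majority_lessThan:
  assumes "\<And>i. i < n \<Longrightarrow> Measurable.pred M (\<lambda>m. v m i)"
  shows "Measurable.pred M (\<lambda>m. majority {..<n} (v m))"
proof -
  have "Measurable.pred M (\<lambda>m. majority {i \<in> {..<n}. True} (v m))"
    using assms by (intro pred_majority) auto
  moreover have "{i \<in> {..<n}. True} = {..<n}" by blast
  ultimately show ?thesis by (simp only:)
qed

section \<open>The two-point distribution and its Bayes error\<close>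

definition point_label :: "(real \<times> bool) measure" where
  "point_label = distr (measure_pmf (bernoulli_pmf (1 / 2))) (borel \<Otimes>\<^sub>M count_space UNIV)
     (\<lambda>b. (of_bool b, b))"

lemma sets_point_label [measurable_cong]:
  "sets point_label = sets (borel \<Otimes>\<^sub>M count_space UNIV)"
  by (simp add: point_label_def)

lemma space_point_label [simp]: "space point_label = UNIV"
  by (simp add: point_label_def space_pair_measure)

lemma measurable_point_label_map [measurable]:
  "(\<lambda>b. (of_bool b, b)) \<in> measure_pmf p \<rightarrow>\<^sub>M borel \<Otimes>\<^sub>M count_space (UNIV :: bool set)"
  by (simp add: space_pair_measure)

lemma prob_space_point_label: "prob_space point_label"
  unfolding point_label_def
  by (rule prob_space.prob_space_distr[OF prob_space_measure_pmf measurable_point_label_map])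

text \<open>The event consists of two points, hence is measurable, and its preimage under the map
  defining the pushforward contains both outcomes of the coin.\<close>

lemma AE_point_label: "AE z in point_label. fst z = of_bool (snd z)"
proof -
  let ?N = "borel \<Otimes>\<^sub>M count_space UNIV :: (real \<times> bool) measure"
  have "{z \<in> space ?N. fst z = of_bool (snd z)} = {1} \<times> {True} \<union> {0} \<times> {False}"
    by (auto simp: space_pair_measure of_bool_def split: if_splits)
  also have "\<dots> \<in> sets ?N"
    by (intro sets.Un pair_measureI) auto
  finally have N: "{z \<in> space ?N. fst z = of_bool (snd z)} \<in> sets ?N" .
  show ?thesis
    unfolding point_label_def AE_distr_iff[OF measurable_point_label_map N] by simp
qed

lemma sets_snd_point_label [measurable]: "{z. snd z = b} \<in> sets point_label"
proof -
  have "{z \<in> space point_label. snd z = b} \<in> sets point_label" by measurable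
  then show ?thesis by simp
qed

lemma measure_point_label_snd: "measure point_label {z. snd z = b} = 1 / 2"
proof -
  have "measure point_label {z. snd z = b} = measure (measure_pmf (bernoulli_pmf (1 / 2))) {b}"
    using sets_snd_point_label[of b] unfolding point_label_def
    by (subst measure_distr) (auto simp: vimage_def space_pair_measure)
  also have "\<dots> = 1 / 2"
    by (cases b) (simp_all add: measure_pmf_single)
  finally show ?thesis .
qed

lemma data_distribution_point_label: "data_distribution point_label"
proof -
  have "AE z in point_label. fst z \<in> {0..1}"
    using AE_point_label by eventually_elim auto
  then show ?thesis
    by (simp add: data_distribution_def prob_space_point_label sets_point_label)
qed

text \<open>Almost surely the label equals \<open>fst\<close>, which is measurable for the
  conditioning sigma-algebra. The conditional expectation is therefore \<open>fst\<close> itself,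
  with values \<open>0\<close> and \<open>1\<close>, and the threshold \<open>1 / 2\<close> recovers
  the label.\<close>

lemma bayes_error_point_label: "bayes_error point_label = 0"
proof -
  let ?F = "vimage_algebra (space point_label) fst (borel :: real measure)"
  interpret prob_space point_label by (rule prob_space_point_label)
  have fst: "fst \<in> borel_measurable point_label" by measurable
  have "subalgebra point_label ?F"
    unfolding subalgebra_def using measurable_sets[OF fst] by (auto simp: sets_vimage_algebra2)
  then interpret finite_measure_subalgebra point_label ?F
    by unfold_locales
  have "AE z in point_label. label_prob point_label z = real_cond_exp point_label ?F fst z"
    unfolding label_prob_def
  proof (rule real_cond_exp_cong)
    show "AE z in point_label. of_bool (snd z) = fst z"
      using AE_point_label by eventually_elim simp
    show "(\<lambda>z. of_bool (snd z)) \<in> borel_measurable point_label"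
      unfolding of_bool_def by measurable
  qed (rule fst)
  moreover have "AE z in point_label. real_cond_exp point_label ?F fst z = fst z"
  proof (rule real_cond_exp_F_meas)
    show "integrable point_label fst"
      using AE_point_label by (intro integrable_const_bound[of _ 1] fst) (auto elim: eventually_mono)
    show "fst \<in> borel_measurable ?F"
      by (rule measurable_vimage_algebra1) simp
  qed
  ultimately have "AE z in point_label. \<not> ((label_prob point_label z > 1 / 2) \<noteq> snd z)"
    using AE_point_label by eventually_elim auto
  moreover have "{z \<in> space point_label. (label_prob point_label z > 1 / 2) \<noteq> snd z}
      \<in> sets point_label"
  proof -
    have [measurable]: "label_prob point_label \<in> borel_measurable point_label"
      unfolding label_prob_def by (rule borel_measurable_cond_exp2)
    show ?thesis by measurable
  qed
  ultimately show ?thesis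
    unfolding bayes_error_def by (subst prob_eq_0) auto
qed

section \<open>The law of the seed at the root\<close>

lemma (in sigma_finite_measure) measure_pair_measure_Times:
  assumes "A \<in> sets N" and "B \<in> sets M"
  shows "measure (N \<Otimes>\<^sub>M M) (A \<times> B) = measure N A * measure M B"
  using assms by (simp add: measure_def emeasure_pair_measure_Times enn2real_mult)

lemma prob_space_node_seed_measure: "prob_space node_seed_measure"
proof -
  interpret E: prob_space "density lborel (exponential_density 1)"
    by (rule prob_space_exponential_density) simp
  interpret U: prob_space "uniform_measure lborel {0..1::real}"
    by (rule prob_space_uniform_measure) auto
  interpret pair_prob_space "density lborel (exponential_density 1)"
    "uniform_measure lborel {0..1::real}" ..
  show ?thesis unfolding node_seed_measure_def by (rule P.prob_space_axioms)
qed

lemma sets_node_seed_measure [measurable_cong]: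
  "sets node_seed_measure = sets (borel \<Otimes>\<^sub>M borel)"
  unfolding node_seed_measure_def by (rule sets_pair_measure_cong) simp_all

lemma space_node_seed_measure [simp]: "space node_seed_measure = UNIV"
  by (simp add: node_seed_measure_def space_pair_measure)

lemma measurable_seed_component [measurable]:
  "(\<lambda>s. s p) \<in> seed_measure \<rightarrow>\<^sub>M borel \<Otimes>\<^sub>M borel"
  using measurable_component_singleton[of p UNIV "\<lambda>_. node_seed_measure"]
  by (simp add: seed_measure_def measurable_cong_sets[OF refl sets_node_seed_measure])

lemma prob_space_seed_measure: "prob_space seed_measure"
  unfolding seed_measure_def by (rule prob_space_PiM) (rule prob_space_node_seed_measure)

lemma space_seed_measure [simp]: "space seed_measure = UNIV"
  by (simp add: seed_measure_def space_PiM PiE_UNIV_domain)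

text \<open>The event is a rectangle: the exponential tail times the whole uniform factor.\<close>

lemma measure_node_seed_gt:
  assumes "lam \<ge> 0"
  shows "measure node_seed_measure {z. fst z > lam} = exp (- lam)"
proof -
  let ?E = "density lborel (exponential_density 1)"
  interpret E: prob_space ?E
    by (rule prob_space_exponential_density) simp
  interpret U: prob_space "uniform_measure lborel {0..1::real}"
    by (rule prob_space_uniform_measure) auto
  interpret pair_prob_space ?E "uniform_measure lborel {0..1::real}" ..
  have "distributed ?E lborel (\<lambda>x. x) (exponential_density 1)"
    by (auto simp: distributed_def distr_id2)
  then have "measure ?E {lam<..} = exp (- lam)"
    using E.exponential_distributedD_gt[of "\<lambda>x. x" 1 lam] assms by (simp add: greaterThan_def)
  moreover have "{z. fst z > lam} = {lam<..} \<times> (UNIV :: real set)" by auto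
  ultimately show ?thesis
    using U.prob_space unfolding node_seed_measure_def by (simp add: U.measure_pair_measure_Times)
qed

lemma sets_root_seed_gt [measurable]: "{s. fst (s []) > lam} \<in> sets seed_measure"
proof -
  have "{s \<in> space seed_measure. fst (s []) > lam} \<in> sets seed_measure" by measurable
  then show ?thesis by simp
qed

text \<open>The root address \<open>[]\<close> is one coordinate of the product, with marginal
  \<open>node_seed_measure\<close>.\<close>

lemma measure_root_seed_gt:
  assumes "lam \<ge> 0"
  shows "measure seed_measure {s. fst (s []) > lam} = exp (- lam)"
proof -
  have "distr seed_measure node_seed_measure (\<lambda>s. s []) = node_seed_measure"
    unfolding seed_measure_def
    by (rule distr_PiM_component) (simp_all add: prob_space_node_seed_measure)
  moreover have "{z. fst z > lam} \<in> sets node_seed_measure"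
  proof -
    have "{z \<in> space node_seed_measure. fst z > lam} \<in> sets node_seed_measure" by measurable
    then show ?thesis by simp
  qed
  then have "measure (distr seed_measure node_seed_measure (\<lambda>s. s [])) {z. fst z > lam}
      = measure seed_measure {s. fst (s []) > lam}"
    by (subst measure_distr)
      (auto simp: vimage_def measurable_cong_sets[OF refl sets_node_seed_measure])
  ultimately show ?thesis using measure_node_seed_gt[OF assms] by simp
qed

section \<open>Trees that are never split\<close>

lemma majority_const:
  assumes "K \<ge> 1"
  shows "majority {..<K} (\<lambda>_. b) = b"
  using assms by (cases b) (auto simp: majority_def)

lemma leaf_cell_Leaf: "leaf_cell Leaf x = UNIV"
proof -
  have "reaches_leaf Leaf y []" for y by simp
  then show ?thesis unfolding leaf_cell_def by blast
qed

text \<open>Dividing by a length of at most \<open>1\<close> can only increase the exponential time.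
  One event about the seed thus prevents the split whatever the sample and its range.\<close>

lemma split_cell_root_Leaf:
  assumes "cell_length (R A) \<le> 1" "0 \<le> lam" "fst (\<omega> []) > lam"
  shows "split_cell R lam \<omega> A 0 = Leaf"
proof (rule split_cell_eq_Leaf)
  have "fst (\<omega> []) \<le> fst (\<omega> []) / cell_length (R A)" if "cell_length (R A) > 0"
    using that assms by (simp add: pos_le_divide_eq mult_left_le)
  then show "\<not> (cell_length (R A) > 0 \<and> 0 + fst (\<omega> []) / cell_length (R A) \<le> lam)"
    using assms by linarith
qed

text \<open>Only sample points inside the unit interval enter the box, so the bound holds for every
  sample and not just almost surely; an empty box has length \<open>0\<close>.\<close>

lemma cell_length_range_box_le: "cell_length (range_box n Z {0..1}) \<le> 1"
proof -
  define S where "S = {fst (Z i) | i. i < n \<and> fst (Z i) \<in> {0..1}}"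
  have "finite S" unfolding S_def by simp
  show ?thesis
  proof (cases "S = {}")
    case True
    then show ?thesis by (simp add: range_box_def S_def cell_length_def)
  next
    case False
    have "Min S \<in> S" "Max S \<in> S" "Min S \<le> Max S"
      using \<open>finite S\<close> False by auto
    then have "Max S \<le> 1" "Min S \<ge> 0" unfolding S_def by auto
    moreover have "range_box n Z {0..1} = {Min S..Max S}"
      using False by (simp only: range_box_def S_def[symmetric] Let_def if_False)
    ultimately show ?thesis
      using \<open>Min S \<le> Max S\<close> by (simp add: cell_length_def)
  qed
qed

section \<open>Measurability of the forest classifier\<close>

lemma pred_forest_classifier:
  fixes \<omega> :: "'m \<Rightarrow> nat \<Rightarrow> seed" and Z :: "'m \<Rightarrow> sample"
  assumes R: "\<And>A. measurable_cell M A \<Longrightarrow> measurable_cell M (\<lambda>m. R m (A m))"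
    and Z: "\<And>i. i < n \<Longrightarrow> (\<lambda>m. Z m i) \<in> M \<rightarrow>\<^sub>M borel \<Otimes>\<^sub>M count_space UNIV"
    and \<omega>: "\<And>k p. k < K \<Longrightarrow> (\<lambda>m. \<omega> m k p) \<in> M \<rightarrow>\<^sub>M borel \<Otimes>\<^sub>M borel"
    and x: "x \<in> borel_measurable M"
  shows "Measurable.pred M (\<lambda>m.
    forest_classifier K n (Z m) (\<lambda>k. split_cell (R m) lam (\<omega> m k) {0..1} 0) (x m))"
proof -
  \<comment> \<open>Stated for an arbitrary random point \<open>y\<close>, since it is applied both
    to the query point and to each sample point.\<close>
  have reach: "Measurable.pred M
      (\<lambda>m. reaches_leaf (split_cell (R m) lam (\<omega> m k) {0..1} 0) (y m) p)"
    if "k < K" "y \<in> borel_measurable M" for k y p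
    by (rule pred_reaches_leaf[OF R]) (auto simp: that \<omega> measurable_cell_unit)
  have "Measurable.pred M (\<lambda>m.
      majority {i \<in> {..<n}. fst (Z m i) \<in> leaf_cell (split_cell (R m) lam (\<omega> m k) {0..1} 0) (x m)}
        (\<lambda>i. snd (Z m i)))" if "k < K" for k
  proof (rule pred_majority)
    fix i assume "i \<in> {..<n}"
    then have [measurable]: "(\<lambda>m. Z m i) \<in> M \<rightarrow>\<^sub>M borel \<Otimes>\<^sub>M count_space UNIV" using Z by simp
    have "(\<lambda>m. fst (Z m i)) \<in> borel_measurable M" by measurable
    note reach = reach[OF \<open>k < K\<close> x] reach[OF \<open>k < K\<close> this]
    \<comment> \<open>Addresses are finite Boolean lists, so the existential quantifier in
      \<open>leaf_cell\<close> is a countable union of measurable events.\<close>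
    show "Measurable.pred M
        (\<lambda>m. fst (Z m i) \<in> leaf_cell (split_cell (R m) lam (\<omega> m k) {0..1} 0) (x m))"
      unfolding leaf_cell_def mem_Collect_eq
      by (intro pred_intros_countable(2) pred_intros_logic(3) reach)
    show "Measurable.pred M (\<lambda>m. snd (Z m i))" by measurable
  qed simp
  then have "Measurable.pred M (\<lambda>m.
      tree_classifier n (Z m) (split_cell (R m) lam (\<omega> m k) {0..1} 0) (x m))" if "k < K" for k
    using that unfolding tree_classifier_def by (simp only: lessThan_iff)
  then show ?thesis
    unfolding forest_classifier_def by (rule pred_majority_lessThan)
qed

section \<open>The lower bound on the risk\<close>

text \<open>When no root splits, the prediction depends on the sample alone, while the new label is
  independent of sample and seeds and takes each value with probability \<open>1 / 2\<close>. The
  assumptions on \<open>R\<close> are what the identity and the range restriction have in common, so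
  both forests are treated at once.\<close>

lemma risk_point_label_ge:
  fixes R :: "sample \<Rightarrow> real set \<Rightarrow> real set"
  assumes K: "K \<ge> 1" and lam: "lam \<ge> 0"
    and R: "\<And>(M :: (sample \<times> (nat \<Rightarrow> seed) \<times> (real \<times> bool)) measure) Z A.
      (\<And>i. i < n \<Longrightarrow> (\<lambda>m. fst (Z m i)) \<in> borel_measurable M) \<Longrightarrow>
      measurable_cell M A \<Longrightarrow> measurable_cell M (\<lambda>m. R (Z m) (A m))"
    and len: "\<And>Z. cell_length (R Z {0..1}) \<le> 1"
  shows "exp (- lam) ^ K / 2 \<le> risk point_label K n
    (\<lambda>Z \<omega>. forest_classifier K n Z (\<lambda>k. split_cell (R Z) lam (\<omega> k) {0..1} 0))"
proof -
  let ?D = point_label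
  let ?P = "PiM {..<n} (\<lambda>_. ?D)"
  let ?W = "PiM {..<K} (\<lambda>_. seed_measure)"
  let ?J = "joint_measure ?D K n"
  let ?g = "\<lambda>Z \<omega>. forest_classifier K n Z (\<lambda>k. split_cell (R Z) lam (\<omega> k) {0..1} 0)"
  interpret D: prob_space ?D by (rule prob_space_point_label)
  interpret S: prob_space seed_measure by (rule prob_space_seed_measure)
  interpret P: prob_space ?P by (rule prob_space_PiM) (rule prob_space_point_label)
  interpret W: prob_space ?W by (rule prob_space_PiM) (rule prob_space_seed_measure)
  interpret WD: pair_prob_space ?W ?D ..
  interpret PWD: pair_prob_space ?P "?W \<Otimes>\<^sub>M ?D" ..
  have J: "?J = ?P \<Otimes>\<^sub>M (?W \<Otimes>\<^sub>M ?D)" by (simp add: joint_measure_def)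

  define E where "E = (\<Pi>\<^sub>E k\<in>{..<K}. {s. fst (s []) > lam} :: seed set)"
  have E: "E \<in> sets ?W"
    unfolding E_def by (intro sets_PiM_I_finite) auto
  interpret FS: finite_product_prob_space "\<lambda>_. seed_measure" "{..<K}"
    by unfold_locales auto
  have mE: "measure ?W E = exp (- lam) ^ K"
    unfolding E_def by (subst FS.finite_measure_PiM_emb) (auto simp: measure_root_seed_gt lam)

  \<comment> \<open>With a single leaf every tree votes for the majority label of the whole sample,
    at every query point.\<close>
  define c where "c Z = majority {..<n} (\<lambda>i. snd (Z i))" for Z :: sample
  have g: "?g Z \<omega> x = c Z" if "\<omega> \<in> E" for Z \<omega> x
  proof -
    have Leaf: "split_cell (R Z) lam (\<omega> k) {0..1} 0 = Leaf" if "k < K" for k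
      using that \<open>\<omega> \<in> E\<close> by (intro split_cell_root_Leaf len lam) (auto simp: E_def PiE_iff)
    have "tree_classifier n Z (split_cell (R Z) lam (\<omega> k) {0..1} 0) x = c Z" if "k < K" for k
      unfolding Leaf[OF that] by (simp add: tree_classifier_def leaf_cell_Leaf c_def lessThan_def)
    then have "{k \<in> {..<K}. tree_classifier n Z (split_cell (R Z) lam (\<omega> k) {0..1} 0) x}
        = {k \<in> {..<K}. c Z}"
      "{k \<in> {..<K}. \<not> tree_classifier n Z (split_cell (R Z) lam (\<omega> k) {0..1} 0) x}
        = {k \<in> {..<K}. \<not> c Z}" by auto
    then have "?g Z \<omega> x = majority {..<K} (\<lambda>_. c Z)"
      unfolding forest_classifier_def majority_def by simp
    then show ?thesis using majority_const[OF K, of "c Z"] by simp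
  qed
  have c: "Measurable.pred ?P c"
    unfolding c_def[abs_def] by (rule pred_majority_lessThan) measurable
  define A where "A b = {Z \<in> space ?P. c Z = b}" for b
  have A: "A b \<in> sets ?P" for b
    using measurable_sets[OF c, of "{b}"] by (simp add: A_def vimage_def Int_def conj_commute)
  \<comment> \<open>On \<open>V b\<close> the forest is forced to predict \<open>b\<close> and the
    true label is the other one. The product form makes the probability factor.\<close>
  define V where "V b = A b \<times> E \<times> {z :: real \<times> bool. snd z = (\<not> b)}" for b
  have V: "V b \<in> sets ?J" for b
    unfolding V_def J by (intro pair_measureI A E sets_snd_point_label)
  have mV: "measure ?J (V b) = measure ?P (A b) * (exp (- lam) ^ K / 2)" for b
    unfolding V_def J
    by (simp add: D.measure_pair_measure_Times WD.P.measure_pair_measure_Times A E mE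
        sets_snd_point_label measure_point_label_snd pair_measureI)
  define F where "F =
    {m \<in> space ?J. ?g (fst m) (fst (snd m)) (fst (snd (snd m))) \<noteq> snd (snd (snd m))}"
  have Z: "(\<lambda>m. fst m i) \<in> ?J \<rightarrow>\<^sub>M borel \<Otimes>\<^sub>M count_space UNIV" if "i < n" for i
  proof -
    have "(\<lambda>Z. Z i) \<in> ?P \<rightarrow>\<^sub>M ?D"
      by (rule measurable_component_singleton) (simp add: that)
    then have "(\<lambda>Z. Z i) \<in> ?P \<rightarrow>\<^sub>M borel \<Otimes>\<^sub>M count_space UNIV"
      by (simp add: measurable_cong_sets[OF refl sets_point_label])
    then show ?thesis unfolding J by (rule measurable_compose[OF measurable_fst])
  qed
  have \<omega>: "(\<lambda>m. fst (snd m) k p) \<in> ?J \<rightarrow>\<^sub>M borel \<Otimes>\<^sub>M borel" if "k < K" for k p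
  proof -
    have "(\<lambda>w. w k) \<in> ?W \<rightarrow>\<^sub>M seed_measure"
      by (rule measurable_component_singleton) (simp add: that)
    then have "(\<lambda>w. w k p) \<in> ?W \<rightarrow>\<^sub>M borel \<Otimes>\<^sub>M borel"
      by (rule measurable_compose) measurable
    moreover have "(\<lambda>m. fst (snd m)) \<in> ?J \<rightarrow>\<^sub>M ?W" unfolding J by measurable
    ultimately show ?thesis by (rule measurable_compose[rotated])
  qed
  have [measurable]: "(\<lambda>m. snd (snd m)) \<in> ?J \<rightarrow>\<^sub>M borel \<Otimes>\<^sub>M count_space UNIV"
    unfolding J by measurable
  have gm: "Measurable.pred ?J (\<lambda>m. ?g (fst m) (fst (snd m)) (fst (snd (snd m))))"
  proof (rule pred_forest_classifier)
    fix A assume "measurable_cell ?J A"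
    then show "measurable_cell ?J (\<lambda>m. R (fst m) (A m))"
      by (intro R measurable_compose[OF Z]) auto
  qed (use Z \<omega> in auto)
  have ym: "Measurable.pred ?J (\<lambda>m. snd (snd (snd m)))" by measurable
  have "Measurable.pred ?J
      (\<lambda>m. ?g (fst m) (fst (snd m)) (fst (snd (snd m))) \<noteq> snd (snd (snd m)))"
    by (intro pred_intros_logic gm ym)
  then have F: "F \<in> sets ?J"
    by (simp only: F_def pred_def)
  interpret J: prob_space ?J unfolding J by (rule PWD.prob_space_axioms)
  \<comment> \<open>The probability of either sample majority is never computed: both cases carry
    the same factor, and the two probabilities sum to \<open>1\<close>.\<close>
  have "exp (- lam) ^ K / 2 = (measure ?P (A True) + measure ?P (A False)) * (exp (- lam) ^ K / 2)"
  proof -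
    have "measure ?P (A True) + measure ?P (A False) = measure ?P (A True \<union> A False)"
      by (intro P.finite_measure_Union[symmetric] A) (auto simp: A_def)
    also have "A True \<union> A False = space ?P" by (auto simp: A_def)
    finally show ?thesis by (simp add: P.prob_space)
  qed
  also have "\<dots> = measure ?J (V True) + measure ?J (V False)"
    by (simp add: mV algebra_simps)
  also have "\<dots> = measure ?J (V True \<union> V False)"
    by (intro J.finite_measure_Union[symmetric] V) (auto simp: V_def)
  also have "\<dots> \<le> measure ?J F"
  proof (rule J.finite_measure_mono[OF _ F])
    show "V True \<union> V False \<subseteq> F"
    proof
      fix m assume m: "m \<in> V True \<union> V False"
      then have "m \<in> space ?J" using sets.sets_into_space[OF V] by blast
      then show "m \<in> F" using m g by (auto simp: F_def V_def A_def)
    qed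
  qed
  also have "\<dots> = risk ?D K n ?g"
    by (simp add: risk_def F_def case_prod_beta')
  finally show ?thesis .
qed

theorem proposition1:
  fixes K :: nat and lam :: real
  assumes "K \<ge> 1" and "lam > 0"
  shows "(\<exists>D. data_distribution D \<and> bayes_error D = 0 \<and>
             \<not> (\<lambda>n. risk D K n (mondrian_forest K lam n)) \<longlonglongrightarrow> 0) \<and>
         (\<exists>D. data_distribution D \<and> bayes_error D = 0 \<and>
             \<not> (\<lambda>n. risk D K n (range_restricted_mondrian_forest K lam n)) \<longlonglongrightarrow> 0)"
proof -
  \<comment> \<open>The lower bound is positive and does not depend on \<open>n\<close>.\<close>
  have not_null: "\<not> f \<longlonglongrightarrow> 0" if "\<And>n. exp (- lam) ^ K / 2 \<le> f n" for f :: "nat \<Rightarrow> real"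
  proof
    assume "f \<longlonglongrightarrow> 0"
    then have "exp (- lam) ^ K / 2 \<le> 0"
      by (rule LIMSEQ_le_const) (use that in blast)
    moreover have "exp (- lam) ^ K / 2 > 0" by simp
    ultimately show False by linarith
  qed
  \<comment> \<open>Here \<open>R\<close> is the identity and the root cell has length exactly
    \<open>1\<close>; the second bound takes \<open>range_box n\<close> for \<open>R\<close>. The
    same distribution serves both claims.\<close>
  have "exp (- lam) ^ K / 2 \<le> risk point_label K n (mondrian_forest K lam n)" for n
    unfolding mondrian_forest_def[abs_def] mondrian_tree_def
    using assms by (intro risk_point_label_ge) (auto simp: cell_length_def)
  moreover have
    "exp (- lam) ^ K / 2 \<le> risk point_label K n (range_restricted_mondrian_forest K lam n)" for n
    unfolding range_restricted_mondrian_forest_def[abs_def] range_restricted_tree_def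
    using assms
    by (intro risk_point_label_ge measurable_cell_range_box cell_length_range_box_le) auto
  ultimately show ?thesis
    using data_distribution_point_label bayes_error_point_label
    by (intro conjI exI[of _ point_label] not_null)
qed

end
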